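(* For every $n\ge1$ there is an involution $\beta$ on the set of Tamari intervals $(P,Q)$ of size $n$ such that for every interval $I=(P,Q)$ with $\beta(I)=(P',Q')$: (i) $c_0(P')=r_0(Q)$ and $r_0(Q')=c_0(P)$; (ii) the multiset $\{c_1(P'),\dots,c_{n-1}(P')\}$ equals the multiset $\{r_1(Q),\dots,r_{n-1}(Q)\}$, and the multiset $\{r_1(Q'),\dots,r_{n-1}(Q')\}$ equals $\{c_1(P),\dots,c_{n-1}(P)\}$; (iii) $\beta$ preserves the distance: $\mathrm{dist}(P',Q')=\mathrm{dist}(P,Q)$.
   Context: Dyck paths of semilength $n$ are words in $U,D$ with $n$ of each and every prefix having at least as many $U$ as $D$; each up-step is matched with the first later down-step returning to its starting height. Tamari order: a rotation takes a down-step $D$ immediately followed by an up-step, lets $W$ be the shortest nonempty Dyck-path factor starting right after it, and replaces $DW$ by $WD$; the Tamari order is the reflexive–transitive closure. A Tamari interval of size $n$ is a pair $(P,Q)$ of Dyck paths of semilength $n$ with $P\le Q$. The distance $\mathrm{dist}(P,Q)$ is the length of a longest chain from $P$ to $Q$ in the Tamari lattice. Contact vector of $P$: $c_0(P)$ is the number of returns of $P$ to height $0$ other than at the start; for $1\le i\le n-1$, $c_i(P)$ is the number of non-initial returns to its starting height of the (possibly empty) Dyck path strictly between the $i$-th up-step of $P$ and its matching down-step. Rise vector of $Q$: $r_0(Q)$ is the number of up-steps before the first down-step; for $1\le i\le n-1$, $r_i(Q)$ is the number of up-steps in the maximal run of up-steps immediately following the $i$-th down-step of $Q$ (zero if that down-step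 is followed by a down-step). *)

theory Defs
  imports Main "HOL-Library.Multiset"
begin

text \<open>Dyck paths are lists of booleans: True = up-step U, False = down-step D.
Positions are 0-indexed.\<close>

definition height :: "bool list \<Rightarrow> nat \<Rightarrow> int" where
  "height w k = int (count_list (take k w) True) - int (count_list (take k w) False)"

definition dyck :: "nat \<Rightarrow> bool list \<Rightarrow> bool" where
  "dyck n w \<longleftrightarrow> length w = 2 * n \<and> count_list w True = n \<and>
     (\<forall>k \<le> length w. height w k \<ge> 0)"

definition match :: "bool list \<Rightarrow> nat \<Rightarrow> nat" where
  "match w i = (LEAST j. i < j \<and> j < length w \<and> height w (Suc j) = height w i)"

text \<open>Rotation at a down-step at position k followed by an up-step at k+1:
W is the factor from k+1 to the matching down-step of that up-step; DW becomes WD.\<close>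
definition rotate_at :: "bool list \<Rightarrow> nat \<Rightarrow> bool list" where
  "rotate_at w k = (let j = match w (Suc k) in
     take k w @ take (j - k) (drop (Suc k) w) @ [False] @ drop (Suc j) w)"

definition rot :: "bool list \<Rightarrow> bool list \<Rightarrow> bool" where
  "rot P Q \<longleftrightarrow> (\<exists>k. Suc k < length P \<and> \<not> P ! k \<and> P ! Suc k \<and> Q = rotate_at P k)"

definition tamari_le :: "bool list \<Rightarrow> bool list \<Rightarrow> bool" where
  "tamari_le = rot\<^sup>*\<^sup>*"

definition tamari_intervals :: "nat \<Rightarrow> (bool list \<times> bool list) set" where
  "tamari_intervals n = {(P, Q). dyck n P \<and> dyck n Q \<and> tamari_le P Q}"

definition dist :: "bool list \<Rightarrow> bool list \<Rightarrow> nat" where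
  "dist P Q = Max {k. \<exists>xs. length xs = Suc k \<and> xs ! 0 = P \<and> xs ! k = Q \<and>
       (\<forall>i < k. tamari_le (xs ! i) (xs ! Suc i) \<and> xs ! i \<noteq> xs ! Suc i)}"

definition ups :: "bool list \<Rightarrow> nat list" where
  "ups w = filter (\<lambda>k. w ! k) [0..<length w]"

definition downs :: "bool list \<Rightarrow> nat list" where
  "downs w = filter (\<lambda>k. \<not> w ! k) [0..<length w]"

text \<open>Contact vector. contact P 0 = non-initial returns to height 0;
contact P i (i \<ge> 1) = non-initial returns to its starting height of the Dyck path strictly
between the i-th up-step (1-indexed) and its matching down-step.\<close>
definition contact :: "bool list \<Rightarrow> nat \<Rightarrow> nat" where
  "contact w i = (if i = 0 then card {k. 1 \<le> k \<and> k \<le> length w \<and> height w k = 0}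
     else (let p = ups w ! (i - 1); m = match w p in
       card {k. p + 2 \<le> k \<and> k \<le> m \<and> height w k = height w (Suc p)}))"

definition up_run :: "bool list \<Rightarrow> nat \<Rightarrow> nat" where
  "up_run w k = length (takeWhile (\<lambda>b. b) (drop k w))"

definition rise :: "bool list \<Rightarrow> nat \<Rightarrow> nat" where
  "rise w i = (if i = 0 then up_run w 0 else up_run w (Suc (downs w ! (i - 1))))"

end

theory Submission
  imports Defs
begin

text \<open>A Dyck path is read as a binary tree through $P = A\,U B D \leftrightarrow (A, B)$; rotations
of paths are then rotations of trees, and the mirror symmetry of trees reverses the Tamari order.
The contacts of a path are the lengths of the left branches of its tree, so the mirror symmetry
turns the contacts of $P$ into the lengths of the right branches of the new upper path.

If $(P_1, Q_1)$ and $(P_2, Q_2)$ are intervals and $P_1 = P_1^l P_1^r$ with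
$i$ returns in $P_1^l$, then $(U P_1^l D P_1^r P_2,\; U Q_1 D Q_2)$ and
$(P_2 U P_1^l D P_1^r,\; Q_2 U Q_1 D)$ are intervals, and each of the two constructions produces
every nonempty interval exactly once. Under both constructions the contacts and the distance obey
the same recursion. The rises of the upper path under the first one obey the same recursion as its
right branch lengths under the second one. Decomposing by the first rule
and reassembling by the second is therefore a bijection $\varphi$ that keeps contacts and distance
and turns rises into right branch lengths. The involution is the mirror symmetry conjugated
by $\varphi$.\<close>

section \<open>Rotations of binary trees\<close>

datatype btree = L | N btree btree

text \<open>Concatenation of paths on the tree side: \<open>a\<close> replaces the leaf at the end
  of the left branch of \<open>b\<close>.\<close>

fun cat :: "btree \<Rightarrow> btree \<Rightarrow> btree" where
  "cat a L = a"
| "cat a (N b c) = N (cat a b) c"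

text \<open>\<open>lb\<close> is the length of the left branch, \<open>lbs\<close> lists the left branch lengths of all
right subtrees in infix order, which is the order of the up-steps of the path.\<close>

fun lb :: "btree \<Rightarrow> nat" where
  "lb L = 0"
| "lb (N a b) = Suc (lb a)"

fun lbs :: "btree \<Rightarrow> nat list" where
  "lbs L = []"
| "lbs (N a b) = lbs a @ [lb b] @ lbs b"

fun mir :: "btree \<Rightarrow> btree" where
  "mir L = L"
| "mir (N a b) = N (mir b) (mir a)"

inductive rt :: "btree \<Rightarrow> btree \<Rightarrow> bool" where
  rt_root: "rt (N (N a b) c) (N a (N b c))"
| rt_left: "rt a a' \<Longrightarrow> rt (N a b) (N a' b)"
| rt_right: "rt b b' \<Longrightarrow> rt (N a b) (N a b')"

lemma rt_to_L: "\<not> rt p L"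
  by (auto elim: rt.cases)

lemma rt_to_N:
  "rt p (N b c) \<Longrightarrow>
    (\<exists>d e. p = N (N b d) e \<and> c = N d e) \<or>
    (\<exists>x. p = N x c \<and> rt x b) \<or> (\<exists>x. p = N b x \<and> rt x c)"
  by (auto elim: rt.cases)

lemma cat_L_left [simp]: "cat L a = a"
  by (induction a) auto

lemma cat_assoc: "cat (cat a b) c = cat a (cat b c)"
  by (induction c) auto

lemma size_cat [simp]: "size (cat a b) = size a + size b"
  by (induction b) auto

lemma lb_cat [simp]: "lb (cat a b) = lb a + lb b"
  by (induction b) auto

lemma lbs_cat [simp]: "lbs (cat a b) = lbs a @ lbs b"
  by (induction b) auto

lemma length_lbs [simp]: "length (lbs t) = size t"
  by (induction t) auto

text \<open>The last node in infix order has a leaf as right subtree. It belongs to the last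
  up-step, whose entry the contact vector omits.\<close>

lemma last_lbs: "t \<noteq> L \<Longrightarrow> last (lbs t) = 0"
proof (induction t)
  case (N a b)
  then show ?case by (cases b) auto
qed auto

lemma mir_mir [simp]: "mir (mir t) = t"
  by (induction t) auto

lemma size_mir [simp]: "size (mir t) = size t"
  by (induction t) auto

lemma cat_eq_size:
  assumes "cat a b = cat a' b'" "size a = size a'"
  shows "a = a' \<and> b = b'"
proof -
  have "size b = size b'"
    using assms by (metis add_left_cancel size_cat)
  then show ?thesis using assms
  proof (induction b arbitrary: b')
    case L
    then show ?case by (cases b') auto
  next
    case (N b c)
    obtain b1 c1 where b': "b' = N b1 c1" using N.prems(1) by (cases b') auto
    then show ?case using N.IH(1)[of b1] N.prems by simp
  qed
qed

text \<open>A cut at height 0 is fixed by the number of returns before it, so the split of a lower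
  path in a code is unambiguous.\<close>

lemma cat_eq_lb:
  assumes "cat a b = cat a' b'" "lb a = lb a'"
  shows "a = a' \<and> b = b'"
proof -
  have "lb b = lb b'"
    using assms by (metis add_left_cancel lb_cat)
  then show ?thesis using assms
  proof (induction b arbitrary: b')
    case L
    then show ?case by (cases b') auto
  next
    case (N b c)
    obtain b1 c1 where b': "b' = N b1 c1" using N.prems(1) by (cases b') auto
    then show ?case using N.IH(1)[of b1] N.prems by simp
  qed
qed

lemma cat_split: "i \<le> lb t \<Longrightarrow> \<exists>a b. t = cat a b \<and> lb a = i"
proof (induction t)
  case L
  then show ?case by (metis cat.simps(1) lb.simps(1) le_zero_eq)
next
  case (N t u)
  show ?case
  proof (cases "i \<le> lb t")
    case True
    then obtain a b where "t = cat a b" "lb a = i" using N.IH(1) by blast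
    then have "N t u = cat a (N b u) \<and> lb a = i" by simp
    then show ?thesis by blast
  next
    case False
    then have "N t u = cat (N t u) L \<and> lb (N t u) = i" using N.prems by simp
    then show ?thesis by blast
  qed
qed

lemma cat_first_split: "t \<noteq> L \<Longrightarrow> \<exists>a b. t = cat (N L a) b"
proof (induction t)
  case (N t u)
  show ?case
  proof (cases t)
    case L
    then show ?thesis by (metis cat.simps(1))
  next
    case (N v w)
    then obtain a b where "t = cat (N L a) b" using N.IH(1) by blast
    then have "N t u = cat (N L a) (N b u)" by simp
    then show ?thesis by blast
  qed
qed auto

lemma rt_size: "rt a b \<Longrightarrow> size a = size b"
  by (induction rule: rt.induct) auto

lemma rt_lb: "rt a b \<Longrightarrow> lb b \<le> lb a"
  by (induction rule: rt.induct) auto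

lemma rt_mir: "rt a b \<Longrightarrow> rt (mir b) (mir a)"
  by (induction rule: rt.induct) (auto intro: rt.intros)

lemma rt_cat_left: "rt a a' \<Longrightarrow> rt (cat a b) (cat a' b)"
  by (induction b) (auto intro: rt.intros)

lemma rt_cat_right: "rt b b' \<Longrightarrow> rt (cat a b) (cat a b')"
  by (induction rule: rt.induct) (auto intro: rt.intros)

text \<open>A rotation only raises heights, so the lower path touches 0 wherever the upper one does.
  Hence a rotation into a concatenation takes place within one factor.\<close>

lemma rt_to_cat:
  "rt p (cat a b) \<Longrightarrow>
    (\<exists>a'. p = cat a' b \<and> rt a' a) \<or> (\<exists>b'. p = cat a b' \<and> rt b' b)"
proof (induction b arbitrary: p)
  case L
  then show ?case by auto
next
  case (N b c)
  from N.prems have "rt p (N (cat a b) c)" by simp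
  then consider (1) b' c' where "p = N (N (cat a b) b') c'" "c = N b' c'"
    | (2) x where "p = N x c" "rt x (cat a b)"
    | (3) x where "p = N (cat a b) x" "rt x c"
    using rt_to_N by blast
  then show ?case
  proof cases
    case 1
    then have "p = cat a (N (N b b') c') \<and> rt (N (N b b') c') (N b c)"
      by (auto intro: rt.intros)
    then show ?thesis by blast
  next
    case 2
    from N.IH(1)[OF 2(2)] show ?thesis
    proof (elim disjE exE conjE)
      fix a' assume "x = cat a' b" "rt a' a"
      then have "p = cat a' (N b c) \<and> rt a' a" using 2 by simp
      then show ?thesis by blast
    next
      fix b' assume "x = cat a b'" "rt b' b"
      then have "p = cat a (N b' c) \<and> rt (N b' c) (N b c)"
        using 2 by (simp add: rt_left)
      then show ?thesis by blast
    qed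
  next
    case 3
    then have "p = cat a (N b x) \<and> rt (N b x) (N b c)" by (simp add: rt_right)
    then show ?thesis by blast
  qed
qed

section \<open>Chains and longest chains\<close>

lemma relpowp_map:
  assumes "\<And>x y. R x y \<Longrightarrow> S (f x) (f y)" "(R ^^ k) x y"
  shows "(S ^^ k) (f x) (f y)"
  using assms(2)
proof (induction k arbitrary: y)
  case (Suc k)
  then obtain z where "(R ^^ k) x z" "R z y" by (meson relpowp_Suc_E)
  then show ?case using Suc.IH assms(1) by (meson relpowp_Suc_I)
qed auto

lemma relpowp_map_rev:
  assumes "\<And>x y. R x y \<Longrightarrow> S (f y) (f x)" "(R ^^ k) x y"
  shows "(S ^^ k) (f y) (f x)"
  using assms(2)
proof (induction k arbitrary: y)
  case (Suc k)
  then obtain z where "(R ^^ k) x z" "R z y" by (meson relpowp_Suc_E)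
  then show ?case using Suc.IH assms(1) by (meson relpowp_Suc_I2)
qed auto

lemma relpowp_add_I: "(R ^^ m) x y \<Longrightarrow> (R ^^ n) y z \<Longrightarrow> (R ^^ (m + n)) x z"
  by (auto simp: relpowp_add)

lemma chain_size: "(rt ^^ k) a b \<Longrightarrow> size a = size b"
proof (induction k arbitrary: b)
  case (Suc k)
  then show ?case by (metis relpowp_Suc_E rt_size)
qed auto

lemma chain_to_cat:
  "(rt ^^ k) p (cat a b) \<Longrightarrow>
    \<exists>a' b' i j. p = cat a' b' \<and> k = i + j \<and> (rt ^^ i) a' a \<and> (rt ^^ j) b' b"
proof (induction k arbitrary: p)
  case 0
  then have "p = cat a b \<and> 0 = (0::nat) + 0 \<and> (rt ^^ 0) a a \<and> (rt ^^ 0) b b" by auto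
  then show ?case by blast
next
  case (Suc k)
  then obtain r where "rt p r" "(rt ^^ k) r (cat a b)" by (meson relpowp_Suc_E2)
  with Suc.IH obtain a' b' i j where
    r: "r = cat a' b'" "k = i + j" "(rt ^^ i) a' a" "(rt ^^ j) b' b" by blast
  from \<open>rt p r\<close>[unfolded r(1)] show ?case
  proof (elim rt_to_cat[THEN disjE] exE conjE)
    fix a'' assume "p = cat a'' b'" "rt a'' a'"
    moreover from this r have "(rt ^^ Suc i) a'' a" by (metis relpowp_Suc_I2)
    ultimately show ?thesis using r by (metis add_Suc)
  next
    fix b'' assume "p = cat a' b''" "rt b'' b'"
    moreover from this r have "(rt ^^ Suc j) b'' b" by (metis relpowp_Suc_I2)
    ultimately show ?thesis using r by (metis add_Suc_right)
  qed
qed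

lemma chain_cat:
  assumes "(rt ^^ i) a' a" "(rt ^^ j) b' b"
  shows "(rt ^^ (i + j)) (cat a' b') (cat a b)"
proof -
  have "(rt ^^ i) (cat a' b') (cat a b')"
    using relpowp_map[where f = "\<lambda>x. cat x b'" and S = rt and R = rt] rt_cat_left assms(1) by blast
  moreover have "(rt ^^ j) (cat a b') (cat a b)"
    using relpowp_map[where f = "\<lambda>x. cat a x" and S = rt and R = rt] rt_cat_right assms(2) by blast
  ultimately show ?thesis by (rule relpowp_add_I)
qed

text \<open>Erase the first up-step and its partner along a chain into \<open>U q D\<close>. Only
  the rotations that merge the first prime factor with the next one are lost, and each of them uses
  up one of the \<open>lb b\<close> later factors.\<close>

lemma chain_to_prime:
  "(rt ^^ k) p (N L q) \<Longrightarrow>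
    \<exists>a b j. p = cat (N L a) b \<and> (rt ^^ j) (cat a b) q \<and> k \<le> j + lb b"
proof (induction k arbitrary: p)
  case 0
  then have "p = cat (N L q) L \<and> (rt ^^ 0) (cat q L) q \<and> 0 \<le> 0 + lb L" by auto
  then show ?case by blast
next
  case (Suc k)
  then obtain r where "rt p r" "(rt ^^ k) r (N L q)" by (meson relpowp_Suc_E2)
  with Suc.IH obtain a b j where
    r: "r = cat (N L a) b" "(rt ^^ j) (cat a b) q" "k \<le> j + lb b" by blast
  from \<open>rt p r\<close>[unfolded r(1)] show ?case
  proof (elim rt_to_cat[THEN disjE] exE conjE)
    fix x assume p: "p = cat x b" and "rt x (N L a)"
    then consider (1) y z where "x = N (N L y) z" "a = N y z"
      | (2) y where "rt y L" | (3) y where "x = N L y" "rt y a"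
      using rt_to_N by blast
    then show ?thesis
    proof cases
      case 1
      \<comment> \<open>Here \<open>p\<close> has one more factor after the first. The erased words
        coincide, so \<open>j\<close> stays and the larger \<open>lb\<close> pays for the
        rotation.\<close>
      have "p = cat (N L y) (cat (N L z) b)"
        using p 1 by (simp add: cat_assoc[symmetric])
      moreover have "cat y (cat (N L z) b) = cat a b"
        using 1 by (simp add: cat_assoc[symmetric])
      moreover have "Suc k \<le> j + lb (cat (N L z) b)" using r(3) by simp
      ultimately show ?thesis using r(2) by metis
    next
      case 2
      then show ?thesis by (simp add: rt_to_L)
    next
      case 3
      then have "(rt ^^ Suc j) (cat y b) q"
        using r(2) rt_cat_left by (metis relpowp_Suc_I2)
      moreover have "p = cat (N L y) b" "Suc k \<le> Suc j + lb b" using p 3 r(3) by auto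
      ultimately show ?thesis by blast
    qed
  next
    fix b' assume p: "p = cat (N L a) b'" and b': "rt b' b"
    then have "(rt ^^ Suc j) (cat a b') q"
      using r(2) rt_cat_right by (metis relpowp_Suc_I2)
    moreover have "Suc k \<le> Suc j + lb b'" using rt_lb[OF b'] r(3) by simp
    ultimately show ?thesis using p by blast
  qed
qed

text \<open>The factors of \<open>b\<close> are absorbed into the first factor one by one from the
  left. This attains the bound in \<open>chain_to_prime\<close>.\<close>

lemma chain_prime_cat: "(rt ^^ lb b) (cat (N L a) b) (N L (cat a b))"
proof (induction b)
  case (N b c)
  have "(rt ^^ lb b) (N (cat (N L a) b) c) (N (N L (cat a b)) c)"
    using relpowp_map[where f = "\<lambda>x. N x c" and S = rt and R = rt] rt_left N.IH(1) by blast
  then show ?case by (auto intro: relpowp_Suc_I rt_root)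
qed auto

text \<open>Counts single rotations, which suit induction; \<open>dist_path\<close> links it to
  \<open>dist\<close>.\<close>

definition longest :: "btree \<Rightarrow> btree \<Rightarrow> nat \<Rightarrow> bool" where
  "longest p q d \<longleftrightarrow> (rt ^^ d) p q \<and> (\<forall>k. (rt ^^ k) p q \<longrightarrow> k \<le> d)"

lemma longest_rtranclp: "longest p q d \<Longrightarrow> rt\<^sup>*\<^sup>* p q"
  unfolding longest_def by (meson relpowp_imp_rtranclp)

lemma longest_mir:
  assumes "longest p q d"
  shows "longest (mir q) (mir p) d"
proof -
  have *: "(rt ^^ k) (mir y) (mir x)" if "(rt ^^ k) x y" for k x y
    using relpowp_map_rev[where f = mir and S = rt and R = rt] rt_mir that by blast
  show ?thesis using assms * unfolding longest_def by (metis mir_mir)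
qed

lemma longest_cat:
  assumes "longest a' a d" "longest b' b e"
  shows "longest (cat a' b') (cat a b) (d + e)"
  unfolding longest_def
proof (intro conjI allI impI)
  show "(rt ^^ (d + e)) (cat a' b') (cat a b)"
    using assms chain_cat by (auto simp: longest_def)
next
  fix k assume "(rt ^^ k) (cat a' b') (cat a b)"
  then obtain x y i j where
    *: "cat a' b' = cat x y" "k = i + j" "(rt ^^ i) x a" "(rt ^^ j) y b"
    using chain_to_cat by blast
  \<comment> \<open>Rotations keep sizes, so both left factors have the size of \<open>a\<close> and
    the two cuts coincide.\<close>
  have "size x = size a'"
    using chain_size[OF *(3)] assms(1) chain_size unfolding longest_def by metis
  then have "a' = x" "b' = y" using cat_eq_size[OF *(1)] by auto
  then show "k \<le> d + e" using * assms by (auto simp: longest_def intro: add_mono)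
qed

text \<open>A longest chain may absorb all factors of \<open>b\<close> first and then rotate below
  the outer pair of steps.\<close>

lemma longest_prime:
  assumes "longest (cat a b) q d"
  shows "longest (cat (N L a) b) (N L q) (d + lb b)"
  unfolding longest_def
proof (intro conjI allI impI)
  have "(rt ^^ d) (N L (cat a b)) (N L q)"
    using relpowp_map[where f = "\<lambda>x. N L x" and S = rt and R = rt] rt_right assms
    unfolding longest_def by blast
  then show "(rt ^^ (d + lb b)) (cat (N L a) b) (N L q)"
    using relpowp_add_I[OF chain_prime_cat] by (metis add.commute)
next
  fix k assume "(rt ^^ k) (cat (N L a) b) (N L q)"
  then obtain x y j where
    *: "cat (N L a) b = cat (N L x) y" "(rt ^^ j) (cat x y) q" "k \<le> j + lb y"
    using chain_to_prime by blast
  \<comment> \<open>Both left factors are prime, of left branch length 1.\<close>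
  then have "a = x" "b = y" using cat_eq_lb[OF *(1)] by auto
  then show "k \<le> d + lb b" using * assms by (force simp: longest_def)
qed

section \<open>Two codings of intervals\<close>

datatype code = E | K code code nat

text \<open>\<open>K x y i\<close> stands for the interval built from the intervals of \<open>x\<close> and \<open>y\<close> by splitting the
lower path of the former after its \<open>i\<close>-th return.\<close>

fun c0 :: "code \<Rightarrow> nat" where
  "c0 E = 0"
| "c0 (K x y i) = Suc (c0 x - i + c0 y)"

fun valid :: "code \<Rightarrow> bool" where
  "valid E = True"
| "valid (K x y i) \<longleftrightarrow> valid x \<and> valid y \<and> i \<le> c0 x"

fun labels :: "code \<Rightarrow> nat multiset" where
  "labels E = {#}"
| "labels (K x y i) = add_mset i (labels x + labels y)"

fun clen :: "code \<Rightarrow> nat" where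
  "clen E = 0"
| "clen (K x y i) = clen x + clen y + (c0 x - i)"

text \<open>With \<open>ss\<close>, the recursion shared by the rises of the upper path under one
  rule and its right branch lengths under the other.\<close>

fun s0 :: "code \<Rightarrow> nat" where
  "s0 E = 0"
| "s0 (K x y i) = Suc (s0 x)"

fun ss :: "code \<Rightarrow> nat multiset" where
  "ss E = {#}"
| "ss (K x y i) = add_mset (s0 y) (ss x + ss y)"

text \<open>The flag selects the rule: the newly built prime factor comes first for
  \<open>True\<close> and last for \<open>False\<close>.\<close>

definition join :: "bool \<Rightarrow> btree \<Rightarrow> btree \<Rightarrow> btree" where
  "join f a b = (if f then cat a b else cat b a)"

text \<open>A relation, so that the cut of the lower path can be an existential witness.\<close>

fun codes :: "bool \<Rightarrow> code \<Rightarrow> btree \<Rightarrow> btree \<Rightarrow> bool" where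
  "codes f E p q \<longleftrightarrow> p = L \<and> q = L"
| "codes f (K x y i) p q \<longleftrightarrow>
    (\<exists>a b q1 p2 q2. codes f x (cat a b) q1 \<and> codes f y p2 q2 \<and> lb a = i \<and>
      p = join f (cat (N L a) b) p2 \<and> q = join f (N L q1) q2)"

text \<open>None of the values depends on \<open>f\<close>, so decoding a code by the other rule
  keeps contacts and distance.\<close>

lemma codes_longest:
  "codes f x p q \<Longrightarrow> valid x \<and> longest p q (clen x) \<and> lb p = c0 x \<and> mset (lbs p) = labels x"
proof (induction x arbitrary: p q)
  case E
  have "k = 0" if "(rt ^^ k) L L" for k
    using that by (cases k) (auto simp: rt_to_L)
  then have "longest L L 0" by (auto simp: longest_def)
  then show ?case using E by auto
next
  case (K x y i)
  then obtain a b q1 p2 q2 where *: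
    "codes f x (cat a b) q1" "codes f y p2 q2" "lb a = i"
    "p = join f (cat (N L a) b) p2" "q = join f (N L q1) q2" by auto
  note IH = K.IH(1)[OF *(1)] K.IH(2)[OF *(2)]
  have "longest (cat (N L a) b) (N L q1) (clen x + lb b)"
    using IH longest_prime by blast
  then have "longest p q (clen x + lb b + clen y)"
    using longest_cat[of "cat (N L a) b" "N L q1" "clen x + lb b" p2 q2 "clen y"]
      longest_cat[of p2 q2 "clen y" "cat (N L a) b" "N L q1" "clen x + lb b"] IH
    unfolding *(4,5) join_def by (cases f) (simp_all add: add.commute add.left_commute)
  moreover have "lb b = c0 x - i" using IH *(3) by auto
  ultimately show ?case using IH *(3,4) by (auto simp: join_def ac_simps)
qed

lemma codes_size: "codes f x p q \<Longrightarrow> size p = size q"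
  using codes_longest chain_size unfolding longest_def by blast

lemma codes_unique: "codes f x p q \<Longrightarrow> codes f x p' q' \<Longrightarrow> p = p' \<and> q = q'"
proof (induction x arbitrary: p q p' q')
  case (K x y i)
  then obtain a b q1 p2 q2 where *:
    "codes f x (cat a b) q1" "codes f y p2 q2" "lb a = i"
    "p = join f (cat (N L a) b) p2" "q = join f (N L q1) q2" by auto
  from K obtain a' b' q1' p2' q2' where **:
    "codes f x (cat a' b') q1'" "codes f y p2' q2'" "lb a' = i"
    "p' = join f (cat (N L a') b') p2'" "q' = join f (N L q1') q2'" by auto
  have "cat a b = cat a' b'" "q1 = q1'" "p2 = p2'" "q2 = q2'"
    using K.IH * ** by blast+
  then show ?case using * ** cat_eq_lb by metis
qed auto

lemma codes_total: "valid x \<Longrightarrow> \<exists>p q. codes f x p q"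
proof (induction x)
  case (K x y i)
  then obtain p1 q1 p2 q2 where *: "codes f x p1 q1" "codes f y p2 q2" by auto
  have "i \<le> lb p1" using codes_longest[OF *(1)] K.prems by simp
  then obtain a b where "p1 = cat a b" "lb a = i" using cat_split by blast
  with * have "codes f (K x y i) (join f (cat (N L a) b) p2) (join f (N L q1) q2)"
    unfolding codes.simps by blast
  then show ?case by blast
next
  case E
  have "codes f E L L" by simp
  then show ?case by blast
qed

lemma join_prime_inject:
  "join f (N L a) b = join f (N L a') b' \<Longrightarrow> a = a' \<and> b = b'"
  using cat_eq_lb[of "N L a" b "N L a'" b'] by (auto simp: join_def split: if_splits)

lemma join_inject_size:
  assumes "join f a b = join f a' b'" "size b = size b'"
  shows "a = a' \<and> b = b'"
proof -
  have "size a + size b = size a' + size b'"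
    using arg_cong[OF assms(1), of size] by (auto simp: join_def split: if_splits)
  then show ?thesis
    using assms cat_eq_size[of a b a' b'] cat_eq_size[of b a b' a']
    by (auto simp: join_def split: if_splits)
qed

text \<open>The upper path determines its first or last prime factor, sizes then determine the cut
  of the lower path, and the label is the left branch length of \<open>a\<close>.\<close>

lemma codes_inject: "codes f x p q \<Longrightarrow> codes f x' p q \<Longrightarrow> x = x'"
proof (induction x arbitrary: x' p q)
  case E
  then show ?case by (cases x') (auto simp: join_def split: if_splits dest: arg_cong[of _ _ size])
next
  case (K x y i)
  then obtain a b q1 p2 q2 where *:
    "codes f x (cat a b) q1" "codes f y p2 q2" "lb a = i"
    "p = join f (cat (N L a) b) p2" "q = join f (N L q1) q2" by auto
  have "q \<noteq> L" using *(5) by (auto simp: join_def dest: arg_cong[of _ _ size])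
  then obtain u v j where x': "x' = K u v j" using K.prems(2) by (cases x') auto
  then obtain a' b' q1' p2' q2' where **:
    "codes f u (cat a' b') q1'" "codes f v p2' q2'" "lb a' = j"
    "p = join f (cat (N L a') b') p2'" "q = join f (N L q1') q2'" using K.prems(2) by auto
  have q: "q1 = q1'" "q2 = q2'" using *(5) **(5) join_prime_inject by metis+
  then have "size p2 = size p2'" using *(2) **(2) codes_size by metis
  then have p: "cat (N L a) b = cat (N L a') b'" "p2 = p2'"
    using *(4) **(4) join_inject_size by metis+
  then have "a = a'" "b = b'" using cat_eq_lb[OF p(1)] by auto
  then show ?case using K.IH * ** q p x' by metis
qed

text \<open>Split off the first or last prime factor of \<open>q\<close>, cut \<open>p\<close> at
  the same place by \<open>chain_to_cat\<close>, and unwrap the factor by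
  \<open>chain_to_prime\<close>. Both remaining upper paths are smaller.\<close>

lemma codes_surj: "rt\<^sup>*\<^sup>* p q \<Longrightarrow> \<exists>x. codes f x p q"
proof (induction q arbitrary: p rule: measure_induct_rule[where f = size])
  case (less q)
  obtain k where k: "(rt ^^ k) p q" using less.prems by (auto simp: rtranclp_power)
  show ?case
  proof (cases "q = L")
    case True
    then have "size p = 0" using chain_size[OF k] by simp
    then have "codes f E p q" using True by (cases p) auto
    then show ?thesis by blast
  next
    case False
    obtain q1 q2 where q: "q = join f (N L q1) q2"
    proof (cases f)
      case True
      then show ?thesis using that cat_first_split[OF False] by (auto simp: join_def)
    next
      case f: False
      with False that show ?thesis by (cases q) (auto simp: join_def)
    qed
    obtain p1 p2 i j where p: "p = join f p1 p2" "(rt ^^ i) p1 (N L q1)" "(rt ^^ j) p2 q2"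
    proof (cases f)
      case True
      then have "(rt ^^ k) p (cat (N L q1) q2)" using k q by (simp add: join_def)
      then show ?thesis using chain_to_cat that True unfolding join_def by metis
    next
      case False
      then have "(rt ^^ k) p (cat q2 (N L q1))" using k q by (simp add: join_def)
      then show ?thesis using chain_to_cat that False unfolding join_def by metis
    qed
    obtain a b l where ab: "p1 = cat (N L a) b" "(rt ^^ l) (cat a b) q1"
      using chain_to_prime[OF p(2)] by blast
    have "size q1 < size q" "size q2 < size q" using q by (auto simp: join_def)
    then obtain x y where "codes f x (cat a b) q1" "codes f y p2 q2"
      using less.IH p(3) ab(2) by (meson rtranclp_power)
    then have "codes f (K x y (lb a)) p q"
      unfolding q p(1) ab(1) codes.simps by blast
    then show ?thesis by blast
  qed
qed

text \<open>Under this rule \<open>q\<close> is \<open>N q2 q1\<close>: its right branch is one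
  longer than that of \<open>q1\<close>, and mirroring makes right branches left ones.\<close>

lemma codes_False_mir:
  "codes False x p q \<Longrightarrow> lb (mir q) = s0 x \<and> mset (lbs (mir q)) = ss x"
  by (induction x arbitrary: p q) (fastforce simp: join_def)+

section \<open>Dyck paths as binary trees\<close>

fun path :: "btree \<Rightarrow> bool list" where
  "path L = []"
| "path (N a b) = path a @ True # path b @ [False]"

lemma path_cat [simp]: "path (cat a b) = path a @ path b"
  by (induction b) auto

lemma length_path [simp]: "length (path t) = 2 * size t"
  by (induction t) auto

lemma count_True_path [simp]: "count_list (path t) True = size t"
  by (induction t) auto

lemma count_False_path [simp]: "count_list (path t) False = size t"
  by (induction t) auto

fun up_len :: "bool list \<Rightarrow> nat" where
  "up_len [] = 0"
| "up_len (b # w) = (if b then Suc (up_len w) else 0)"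

fun later_rises :: "bool list \<Rightarrow> nat multiset" where
  "later_rises [] = {#}"
| "later_rises (b # w) = (if b then later_rises w else add_mset (up_len w) (later_rises w))"

lemma up_len_append_False: "up_len (w @ False # v) = up_len w"
  by (induction w) auto

lemma later_rises_append_False:
  "later_rises (w @ False # v) = add_mset (up_len v) (later_rises w + later_rises v)"
  by (induction w) (auto simp: up_len_append_False)

text \<open>In \<open>U Q1 D Q2\<close> the initial run of \<open>Q1\<close> grows by one, and the
  new down-step is followed by the initial run of \<open>Q2\<close>.\<close>

lemma codes_True_rises:
  "codes True x p q \<Longrightarrow> up_len (path q) = s0 x \<and> later_rises (path q) = ss x"
  by (induction x arbitrary: p q)
    (fastforce simp: join_def up_len_append_False later_rises_append_False)+


section \<open>Heights, matching steps and returns of tree paths\<close>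

lemma height_append: "height (a @ b) k = height a k + height b (k - length a)"
  by (simp add: height_def)

lemma height_Cons: "height (b # w) k = (if k = 0 then 0 else (if b then 1 else -1) + height w (k - 1))"
  by (cases k) (auto simp: height_def)

lemma height_Nil [simp]: "height [] k = 0"
  by (simp add: height_def)

lemma height_0 [simp]: "height w 0 = 0"
  by (simp add: height_def)

lemma height_path_end: "2 * size t \<le> k \<Longrightarrow> height (path t) k = 0"
  by (simp add: height_def)

lemma height_path_nonneg: "0 \<le> height (path t) k"
proof (induction t arbitrary: k)
  case (N a b)
  show ?case
  proof (cases "k - 2 * size a")
    case 0
    then show ?thesis using N.IH(1)[of k] by (simp add: height_append)
  next
    case (Suc j)
    then have "height (path a) k = 0" by (intro height_path_end) simp
    moreover have "0 \<le> height (path b) j" by (rule N.IH(2))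
    ultimately show ?thesis using Suc by (simp add: height_append height_Cons)
  qed
qed simp

lemma height_inside:
  "length x < k \<Longrightarrow> k \<le> Suc (length x + 2 * size b) \<Longrightarrow>
    height (x @ True # path b @ False # y) k =
    height x (length x) + 1 + height (path b) (k - Suc (length x))"
  by (simp add: height_append height_Cons) (simp add: height_def)

text \<open>Strictly between the two steps the height stays above its start, as
  \<open>path b\<close> is nonnegative. The words \<open>x\<close> and \<open>y\<close> are
  arbitrary, which covers nested up-steps.\<close>

lemma match_path:
  "match (x @ True # path b @ False # y) (length x) = Suc (length x + 2 * size b)"
  unfolding match_def
proof (rule Least_equality)
  let ?w = "x @ True # path b @ False # y"
  have 0: "height ?w (length x) = height x (length x)" by (simp add: height_append)
  have "height ?w (Suc (Suc (length x + 2 * size b))) = height x (length x)"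
    by (simp add: height_append height_Cons height_path_end) (simp add: height_def)
  then show "length x < Suc (length x + 2 * size b) \<and> Suc (length x + 2 * size b) < length ?w \<and>
    height ?w (Suc (Suc (length x + 2 * size b))) = height ?w (length x)"
    using 0 by simp
  fix j
  assume j: "length x < j \<and> j < length ?w \<and> height ?w (Suc j) = height ?w (length x)"
  show "Suc (length x + 2 * size b) \<le> j"
  proof (rule ccontr)
    assume "\<not> ?thesis"
    then have "height ?w (Suc j) = height x (length x) + 1 + height (path b) (Suc j - Suc (length x))"
      using j by (intro height_inside) auto
    then show False using j 0 height_path_nonneg[of b "Suc j - Suc (length x)"] by simp
  qed
qed

lemma returns_path:
  "card {k. 1 \<le> k \<and> k \<le> length (path t) \<and> height (path t) k = 0} = lb t"
proof (induction t)
  case (N a b)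
  let ?S = "\<lambda>t. {k. 1 \<le> k \<and> k \<le> length (path t) \<and> height (path t) k = 0}"
  let ?n = "2 * size (N a b)"
  have "?S (N a b) = insert ?n (?S a)"
  proof (rule set_eqI)
    fix k
    consider "k \<le> 2 * size a" | "2 * size a < k" "k \<le> Suc (2 * size a + 2 * size b)" | "k = ?n"
      | "?n < k" by fastforce
    then show "k \<in> ?S (N a b) \<longleftrightarrow> k \<in> insert ?n (?S a)"
    proof cases
      case 1
      then show ?thesis by (auto simp: height_append)
    next
      case 2
      then have "height (path (N a b)) k = 1 + height (path b) (k - Suc (2 * size a))"
        using height_inside[of "path a" k b "[]"] height_path_end[of a "2 * size a"] by simp
      then show ?thesis using 2 height_path_nonneg[of b "k - Suc (2 * size a)"] by auto
    next
      case 3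
      then show ?thesis using height_path_end[of "N a b" k] by auto
    next
      case 4
      then show ?thesis by auto
    qed
  qed
  moreover have "finite (?S a)" "?n \<notin> ?S a" by auto
  ultimately show ?case using N.IH(1) by simp
qed auto

text \<open>Contacts indexed by the position of the up-step instead of its rank.\<close>

definition inner_contact :: "bool list \<Rightarrow> nat \<Rightarrow> nat" where
  "inner_contact w p = card {k. p + 2 \<le> k \<and> k \<le> match w p \<and> height w k = height w (Suc p)}"

lemma inner_contact_path:
  "inner_contact (x @ True # path b @ False # y) (length x) = lb b"
proof -
  let ?w = "x @ True # path b @ False # y"
  let ?S = "{k. 1 \<le> k \<and> k \<le> length (path b) \<and> height (path b) k = 0}"
  have h: "height ?w (Suc (length x + k)) = height x (length x) + 1 + height (path b) k"
    if "k \<le> 2 * size b" for k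
    using height_inside[of x "Suc (length x + k)" b y] that by simp
  have "{k. length x + 2 \<le> k \<and> k \<le> match ?w (length x) \<and> height ?w k = height ?w (Suc (length x))}
    = (\<lambda>k. Suc (length x + k)) ` ?S" (is "?A = ?B")
  proof
    show "?A \<subseteq> ?B"
    proof
      fix k assume k: "k \<in> ?A"
      define j where "j = k - Suc (length x)"
      have "k = Suc (length x + j)" "1 \<le> j" "j \<le> 2 * size b"
        using k by (auto simp: j_def match_path)
      moreover from this have "height (path b) j = 0" using k h[of j] h[of 0] by simp
      ultimately show "k \<in> ?B" by simp
    qed
    show "?B \<subseteq> ?A" using h h[of 0] by (auto simp: match_path)
  qed
  then show ?thesis
    unfolding inner_contact_def using returns_path[of b] by (simp add: card_image inj_on_def)
qed

section \<open>Contact and rise vectors as multisets\<close>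

lemma filter_upt_append:
  "filter (\<lambda>k. P ((a @ b) ! k)) [0..<length (a @ b)] =
    filter (\<lambda>k. P (a ! k)) [0..<length a] @ map ((+) (length a)) (filter (\<lambda>k. P (b ! k)) [0..<length b])"
proof -
  have "[0..<length (a @ b)] = [0..<length a] @ map ((+) (length a)) [0..<length b]"
    using upt_add_eq_append[of 0 "length a" "length b"] map_add_upt[of "length a" "length b"]
    by (simp add: add.commute[of _ "length a"])
  moreover have "filter (\<lambda>k. P ((a @ b) ! k)) [0..<length a] = filter (\<lambda>k. P (a ! k)) [0..<length a]"
    by (rule filter_cong) (auto simp: nth_append)
  ultimately show ?thesis by (simp add: filter_map comp_def)
qed

lemma ups_append: "ups (a @ b) = ups a @ map ((+) (length a)) (ups b)"
  unfolding ups_def using filter_upt_append[of "\<lambda>x. x"] by simp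

lemma downs_append: "downs (a @ b) = downs a @ map ((+) (length a)) (downs b)"
  unfolding downs_def using filter_upt_append[of Not] by simp

lemma ups_Cons: "ups (b # w) = (if b then [0] else []) @ map Suc (ups w)"
  using ups_append[of "[b]" w] by (simp add: ups_def)

lemma downs_Cons: "downs (b # w) = (if b then [] else [0]) @ map Suc (downs w)"
  using downs_append[of "[b]" w] by (simp add: downs_def)

lemma ups_Nil [simp]: "ups [] = []" and downs_Nil [simp]: "downs [] = []"
  by (simp_all add: ups_def downs_def)

lemma length_ups: "length (ups w) = count_list w True"
  by (induction w) (auto simp: ups_Cons)

lemma length_downs: "length (downs w) = count_list w False"
  by (induction w) (auto simp: downs_Cons)

text \<open>The context \<open>x\<close>, \<open>y\<close> is needed for the induction, since
  contacts of a subtree are evaluated inside the whole word.\<close>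

lemma map_inner_contact:
  "map (\<lambda>k. inner_contact (x @ path t @ y) (length x + k)) (ups (path t)) = lbs t"
proof (induction t arbitrary: x y)
  case (N a b)
  show ?case
    using N.IH(1)[of x "True # path b @ False # y"]
      N.IH(2)[of "x @ path a @ [True]" "False # y"]
      inner_contact_path[of "x @ path a" b y]
    by (simp add: ups_append ups_Cons comp_def add.assoc)
qed simp

text \<open>The vectors stop at index \<open>n - 1\<close> while the lists have \<open>n\<close>
  entries; the missing entry is 0 for contacts and rises alike.\<close>

lemma mset_map_except_last:
  assumes "length xs = n" "n \<ge> 1" "g (last xs) = 0"
    and "\<And>i. 1 \<le> i \<Longrightarrow> i \<le> n \<Longrightarrow> f i = g (xs ! (i - 1))"
  shows "add_mset (0::nat) (mset (map f [1..<n])) = mset (map g xs)"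
proof -
  have "map f [1..<Suc n] = map g xs"
    using assms(1,4) by (intro nth_equalityI) (auto simp del: upt_Suc)
  moreover have "f n = 0"
    using assms by (metis One_nat_def last_conv_nth le_refl length_0_conv not_one_le_zero)
  ultimately have "map f [1..<n] @ [0] = map g xs" using assms(2) by simp
  then have "mset (map f [1..<n] @ [0]) = mset (map g xs)" by (rule arg_cong)
  then show ?thesis by simp
qed

lemma contact_path_0: "contact (path t) 0 = lb t"
  using returns_path by (simp add: contact_def)

lemma contacts_path:
  assumes "t \<noteq> L"
  shows "add_mset 0 (mset (map (contact (path t)) [1..<size t])) = mset (lbs t)"
proof -
  have l: "map (inner_contact (path t)) (ups (path t)) = lbs t"
    using map_inner_contact[of "[]" t "[]"] by simp
  have n: "ups (path t) \<noteq> []" "size t \<ge> 1"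
    using assms length_ups[of "path t"] by (cases t; force)+
  have "inner_contact (path t) (last (ups (path t))) = 0"
    using last_lbs[OF assms] l n(1) by (metis last_map)
  then show ?thesis
    unfolding l[symmetric] using n(2)
    by (intro mset_map_except_last) (auto simp: length_ups contact_def inner_contact_def Let_def)
qed

lemma up_run_eq: "up_run w k = up_len (drop k w)"
proof -
  have "length (takeWhile (\<lambda>b. b) v) = up_len v" for v
    by (induction v) auto
  then show ?thesis by (simp add: up_run_def)
qed

lemma rise_0: "rise w 0 = up_len w"
  by (simp add: rise_def up_run_eq)

lemma map_up_run_downs: "mset (map (\<lambda>k. up_run w (Suc k)) (downs w)) = later_rises w"
  by (induction w) (auto simp: downs_Cons up_run_eq comp_def)

lemma rises_path:
  assumes "t \<noteq> L"
  shows "add_mset 0 (mset (map (rise (path t)) [1..<size t])) = later_rises (path t)"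
proof -
  obtain u where u: "path t = u @ [False]" using assms by (cases t) auto
  have "last (downs (path t)) = length u" by (simp add: u downs_append downs_Cons)
  then have "up_run (path t) (Suc (last (downs (path t)))) = 0"
    by (simp add: u up_run_eq)
  moreover have "size t \<ge> 1" using assms by (cases t) auto
  ultimately show ?thesis
    unfolding map_up_run_downs[symmetric]
    by (intro mset_map_except_last) (auto simp: length_downs rise_def)
qed

section \<open>Parsing Dyck words into trees\<close>

fun stack :: "btree list \<Rightarrow> bool list" where
  "stack [] = []"
| "stack [t] = path t"
| "stack (t # s # ts) = stack (s # ts) @ True # path t"

lemma height_stack:
  "length (stack (t # ts)) \<le> k \<Longrightarrow> height (stack (t # ts)) k = int (length ts)"
proof (induction ts arbitrary: t k)
  case (Cons s ts)
  then show ?case using Cons.IH[of s k] by (simp add: height_append height_Cons height_path_end)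
qed (simp add: height_path_end)

text \<open>A nonnegative prefix is cut at its unmatched up-steps, innermost tree first. An up-step
  pushes a leaf, a down-step merges the two top trees; with only one tree left it would make the
  height negative.\<close>

lemma nonneg_imp_stack:
  "(\<And>k. k \<le> length w \<Longrightarrow> 0 \<le> height w k) \<Longrightarrow> \<exists>t ts. w = stack (t # ts)"
proof (induction w rule: rev_induct)
  case Nil
  have "[] = stack [L]" by simp
  then show ?case by blast
next
  case (snoc b w)
  have "0 \<le> height w k" if "k \<le> length w" for k
    using snoc.prems[of k] that by (simp add: height_append)
  then obtain t ts where w: "w = stack (t # ts)" using snoc.IH by blast
  show ?case
  proof (cases b)
    case True
    then have "w @ [b] = stack (L # t # ts)" using w by simp
    then show ?thesis by blast
  next
    case False
    show ?thesis
    proof (cases ts)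
      case Nil
      then show ?thesis
        using snoc.prems[of "Suc (length w)"] w False
        by (simp add: height_append height_Cons height_path_end)
    next
      case (Cons s rs)
      then have "w @ [b] = stack (N s t # rs)" using w False by (cases rs) auto
      then show ?thesis by blast
    qed
  qed
qed

lemma dyck_path [simp]: "dyck n (path t) \<longleftrightarrow> size t = n"
  by (auto simp: dyck_def height_path_nonneg)

lemma dyck_imp_path:
  assumes "dyck n w"
  obtains t where "w = path t" "size t = n"
proof -
  obtain t ts where w: "w = stack (t # ts)"
    using nonneg_imp_stack[of w] assms by (auto simp: dyck_def)
  have "count_list w True + count_list w False = length w"
    by (induction w) auto
  then have "height w (length w) = 0" using assms by (simp add: dyck_def height_def)
  then have "ts = []" using height_stack[of t ts "length w"] w by simp
  then show ?thesis using that[of t] assms w by simp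
qed

text \<open>A parser recovering the tree from its path, which makes \<open>path\<close> injective.
  The last clause is the default for a down-step with fewer than two trees.\<close>

fun push :: "btree list \<Rightarrow> bool \<Rightarrow> btree list" where
  "push ts True = L # ts"
| "push (t # s # ts) False = N s t # ts"
| "push ts False = ts"

lemma foldl_push_path: "foldl push (s # ts) (path t) = cat s t # ts"
  by (induction t arbitrary: s ts) auto

lemma path_inject [simp]: "path s = path t \<longleftrightarrow> s = t"
  using foldl_push_path[of L "[]"] by (metis cat_L_left list.inject)

section \<open>Rotations of paths and of trees\<close>

lemma rotate_at_path:
  "rotate_at (x @ False # True # path b @ False # y) (length x) =
    x @ True # path b @ False # False # y"
  using match_path[of "x @ [False]" b y]
  by (simp add: rotate_at_def Let_def numeral_3_eq_3)

lemma rt_path: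
  "rt s t \<Longrightarrow> \<exists>x b y. path s = x @ False # True # path b @ False # y \<and>
    path t = x @ True # path b @ False # False # y"
proof (induction rule: rt.induct)
  case (rt_root a b c)
  have "path (N (N a b) c) = (path a @ True # path b) @ False # True # path c @ False # [] \<and>
    path (N a (N b c)) = (path a @ True # path b) @ True # path c @ False # False # []" by simp
  then show ?case by blast
next
  case (rt_left a a' b)
  then obtain x c y where "path a = x @ False # True # path c @ False # y"
    "path a' = x @ True # path c @ False # False # y" by blast
  then have "path (N a b) = x @ False # True # path c @ False # (y @ True # path b @ [False]) \<and>
    path (N a' b) = x @ True # path c @ False # False # (y @ True # path b @ [False])" by simp
  then show ?case by blast
next
  case (rt_right b b' a)
  then obtain x c y where "path b = x @ False # True # path c @ False # y"
    "path b' = x @ True # path c @ False # False # y" by blast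
  then have "path (N a b) = (path a @ True # x) @ False # True # path c @ False # (y @ [False]) \<and>
    path (N a b') = (path a @ True # x) @ True # path c @ False # False # (y @ [False])" by simp
  then show ?case by blast
qed

text \<open>Converse of \<open>rt_path\<close>: every valley of a path comes from a tree
  rotation.\<close>

lemma valley_rt:
  "path s = x @ False # True # z \<Longrightarrow>
    \<exists>b y t. z = path b @ False # y \<and> path t = x @ True # path b @ False # False # y \<and> rt s t"
proof (induction s arbitrary: x z)
  case (N u v)
  from N.prems have eq: "path u @ True # path v @ [False] = x @ False # True # z" by simp
  \<comment> \<open>The valley lies in \<open>path u\<close>, at its junction with the last prime
    factor, or inside that factor.\<close>
  then consider (1) z' where "path u = x @ False # True # z'" "z = z' @ True # path v @ [False]"
    | (2) "path u = x @ [False]" "z = path v @ [False]"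
    | (3) x' where "x = path u @ True # x'" "path v @ [False] = x' @ False # True # z"
    by (auto simp: append_eq_append_conv2 Cons_eq_append_conv append_eq_Cons_conv)
  then show ?case
  proof cases
    case 1
    with N.IH(1) obtain b y t where
      "z' = path b @ False # y" "path t = x @ True # path b @ False # False # y" "rt u t" by blast
    then have "z = path b @ False # (y @ True # path v @ [False]) \<and>
      path (N t v) = x @ True # path b @ False # False # (y @ True # path v @ [False]) \<and>
      rt (N u v) (N t v)" using 1 by (simp add: rt.intros)
    then show ?thesis by blast
  next
    case 2
    then obtain c d where u: "u = N c d" by (cases u) auto
    then have "z = path v @ False # [] \<and> path (N c (N d v)) = x @ True # path v @ False # False # [] \<and>
      rt (N u v) (N c (N d v))" using 2 by (auto simp: rt.intros)
    then show ?thesis by blast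
  next
    case 3
    \<comment> \<open>An empty \<open>z\<close> would make the word end in an up-step.\<close>
    from 3(2) obtain z' where z: "z = z' @ [False]" "path v = x' @ False # True # z'"
      by (cases z rule: rev_cases) auto
    with N.IH(2) obtain b y t where
      "z' = path b @ False # y" "path t = x' @ True # path b @ False # False # y" "rt v t" by blast
    then have "z = path b @ False # (y @ [False]) \<and>
      path (N u t) = x @ True # path b @ False # False # (y @ [False]) \<and>
      rt (N u v) (N u t)" using 3 z by (simp add: rt.intros)
    then show ?thesis by blast
  qed
qed simp

lemma rot_path: "rot (path s) w \<longleftrightarrow> (\<exists>t. w = path t \<and> rt s t)"
proof
  assume "rot (path s) w"
  then obtain k where k: "Suc k < length (path s)" "\<not> path s ! k" "path s ! Suc k"
    "w = rotate_at (path s) k" by (auto simp: rot_def)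
  define x z where "x = take k (path s)" and "z = drop (Suc (Suc k)) (path s)"
  have s: "path s = x @ False # True # z"
    using k unfolding x_def z_def
    by (metis (full_types) Cons_nth_drop_Suc Suc_lessD append_take_drop_id)
  obtain b y t where *: "z = path b @ False # y" "path t = x @ True # path b @ False # False # y" "rt s t"
    using valley_rt[OF s] by blast
  have "length x = k" using k(1) by (simp add: x_def)
  then have "w = path t" using rotate_at_path[of x b y] k(4) s * by simp
  then show "\<exists>t. w = path t \<and> rt s t" using * by blast
next
  assume "\<exists>t. w = path t \<and> rt s t"
  then obtain t where t: "w = path t" "rt s t" by blast
  from rt_path[OF t(2)] obtain x b y where
    *: "path s = x @ False # True # path b @ False # y"
    "path t = x @ True # path b @ False # False # y" by blast
  have "w = rotate_at (path s) (length x)"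
    using rotate_at_path[of x b y] * t(1) by simp
  then show "rot (path s) w"
    unfolding rot_def using * by (intro exI[of _ "length x"]) (simp add: nth_append)
qed

lemma tamari_le_path: "tamari_le (path s) w \<longleftrightarrow> (\<exists>t. w = path t \<and> rt\<^sup>*\<^sup>* s t)"
proof
  assume "tamari_le (path s) w"
  then show "\<exists>t. w = path t \<and> rt\<^sup>*\<^sup>* s t"
    unfolding tamari_le_def
  proof (induction rule: rtranclp_induct)
    case (step v w)
    then show ?case using rot_path by (meson rtranclp.rtrancl_into_rtrancl)
  qed auto
next
  have "rt\<^sup>*\<^sup>* s t \<Longrightarrow> tamari_le (path s) (path t)" for t
    unfolding tamari_le_def
  proof (induction rule: rtranclp_induct)
    case (step u v)
    then have "rot (path u) (path v)" by (simp add: rot_path)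
    with step.IH show ?case by (rule rtranclp.rtrancl_into_rtrancl)
  qed auto
  then show "\<exists>t. w = path t \<and> rt\<^sup>*\<^sup>* s t \<Longrightarrow> tamari_le (path s) w" by blast
qed

section \<open>Distance as number of rotations\<close>

lemma rt_neq: "rt s t \<Longrightarrow> s \<noteq> t"
  using rt_path by fastforce

text \<open>Each strict comparison expands into at least one rotation, so refining a chain never
  shortens it.\<close>

lemma le_chain_imp_rt_chain:
  assumes "f 0 = path s" "\<And>i. i < k \<Longrightarrow> tamari_le (f i) (f (Suc i)) \<and> f i \<noteq> f (Suc i)"
  shows "\<exists>t m. f k = path t \<and> (rt ^^ m) s t \<and> k \<le> m"
  using assms(2)
proof (induction k)
  case 0
  have "f 0 = path s \<and> (rt ^^ 0) s s \<and> 0 \<le> (0::nat)" using assms(1) by simp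
  then show ?case by blast
next
  case (Suc k)
  then obtain t m where *: "f k = path t" "(rt ^^ m) s t" "k \<le> m" by auto
  then obtain u where u: "f (Suc k) = path u" "rt\<^sup>*\<^sup>* t u" "t \<noteq> u"
    using Suc.prems[of k] by (auto simp: tamari_le_path)
  then obtain j where j: "(rt ^^ j) t u" by (meson rtranclp_power)
  then have "j \<noteq> 0" using u(3) by (cases j) auto
  then have "Suc k \<le> m + j" using *(3) by simp
  then show ?case using u(1) relpowp_add_I[OF *(2) j] by blast
qed

lemma dist_path:
  assumes "longest s t d"
  shows "dist (path s) (path t) = d"
  unfolding dist_def
proof (rule Max_eqI)
  let ?S = "{k. \<exists>xs. length xs = Suc k \<and> xs ! 0 = path s \<and> xs ! k = path t \<and>
       (\<forall>i < k. tamari_le (xs ! i) (xs ! Suc i) \<and> xs ! i \<noteq> xs ! Suc i)}"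
  show le: "k \<le> d" if k: "k \<in> ?S" for k
  proof -
    from k obtain xs where xs: "xs ! 0 = path s" "xs ! k = path t"
      "\<And>i. i < k \<Longrightarrow> tamari_le (xs ! i) (xs ! Suc i) \<and> xs ! i \<noteq> xs ! Suc i" by blast
    obtain m where "(rt ^^ m) s t" "k \<le> m"
      using le_chain_imp_rt_chain[of "(!) xs" s k] xs by auto
    then show ?thesis using assms by (force simp: longest_def)
  qed
  then have "?S \<subseteq> {..d}" by auto
  then show "finite ?S" using finite_subset by blast
  obtain f where f: "f 0 = s" "f d = t" "\<And>i. i < d \<Longrightarrow> rt (f i) (f (Suc i))"
    using assms by (auto simp: longest_def relpowp_fun_conv)
  have "tamari_le (path (f i)) (path (f (Suc i))) \<and> f i \<noteq> f (Suc i)" if "i < d" for i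
    using f(3)[OF that] rt_neq by (auto simp: tamari_le_path)
  then show "d \<in> ?S"
    using f by (auto intro!: exI[of _ "map (\<lambda>i. path (f i)) [0..<Suc d]"] simp del: upt_Suc)
qed

lemma tamari_intervals_path:
  "(P, Q) \<in> tamari_intervals n \<longleftrightarrow>
    (\<exists>p q. P = path p \<and> Q = path q \<and> size p = n \<and> size q = n \<and> rt\<^sup>*\<^sup>* p q)"
  unfolding tamari_intervals_def
  by (auto simp: tamari_le_path elim!: dyck_imp_path)

section \<open>The involution\<close>

text \<open>The interval \<open>(r, s)\<close> is the image of \<open>(p, q)\<close> under the
  bijection \<phi>; its mirror \<open>(mir s, mir r)\<close> is sent back by the inverse.\<close>

definition swaps :: "btree \<Rightarrow> btree \<Rightarrow> btree \<Rightarrow> btree \<Rightarrow> bool" where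
  "swaps p q p' q' \<longleftrightarrow> (\<exists>x y r s. codes True x p q \<and> codes False x r s \<and>
    codes False y (mir s) (mir r) \<and> codes True y p' q')"

lemma swaps_sym: "swaps p q p' q' \<Longrightarrow> swaps p' q' p q"
  unfolding swaps_def by (metis mir_mir)

lemma swaps_unique: "swaps p q p' q' \<Longrightarrow> swaps p q p'' q'' \<Longrightarrow> p' = p'' \<and> q' = q''"
  unfolding swaps_def by (metis codes_inject codes_unique)

lemma swaps_total:
  assumes "rt\<^sup>*\<^sup>* p q"
  shows "\<exists>p' q'. swaps p q p' q'"
proof -
  obtain x where x: "codes True x p q" using codes_surj[OF assms] by blast
  then obtain r s where rs: "codes False x r s" using codes_longest codes_total by meson
  then have "rt\<^sup>*\<^sup>* (mir s) (mir r)"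
    using codes_longest longest_mir longest_rtranclp by blast
  then obtain y where y: "codes False y (mir s) (mir r)" using codes_surj by blast
  then obtain p' q' where "codes True y p' q'" using codes_longest codes_total by meson
  then show ?thesis using x rs y unfolding swaps_def by blast
qed

text \<open>Values are carried along the codes, for instance
  \<open>lb p' = c0 y = lb (mir s) = s0 x = up_len (path q)\<close>.\<close>

lemma swaps_stats:
  assumes "swaps p q p' q'"
  shows "rt\<^sup>*\<^sup>* p' q'" "size p' = size p" "size q' = size p"
    "lb p' = up_len (path q)" "up_len (path q') = lb p"
    "mset (lbs p') = later_rises (path q)" "later_rises (path q') = mset (lbs p)"
    "dist (path p') (path q') = dist (path p) (path q)"
proof -
  obtain x y r s where *: "codes True x p q" "codes False x r s"
    "codes False y (mir s) (mir r)" "codes True y p' q'"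
    using assms unfolding swaps_def by blast
  note c = *[THEN codes_longest]
  note t = *(1,4)[THEN codes_True_rises] and f = *(2,3)[THEN codes_False_mir, unfolded mir_mir]
  show "rt\<^sup>*\<^sup>* p' q'" using c(4) longest_rtranclp by blast
  have "size p = size r" using c(1,2) by (metis length_lbs size_mset)
  moreover have "size p' = size (mir s)" using c(3,4) by (metis length_lbs size_mset)
  ultimately show "size p' = size p" using codes_size[OF *(2)] by simp
  then show "size q' = size p" using codes_size[OF *(4)] by simp
  show "lb p' = up_len (path q)" "up_len (path q') = lb p"
    "mset (lbs p') = later_rises (path q)" "later_rises (path q') = mset (lbs p)"
    using c t f by simp_all
  have "longest (mir s) (mir r) (clen x)" using c(2) longest_mir by blast
  \<comment> \<open>Both are longest chain lengths of the same mirrored interval.\<close>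
  then have "clen x = clen y" using c(3) by (auto simp: longest_def intro: antisym)
  then show "dist (path p') (path q') = dist (path p) (path q)"
    using c(1,4) dist_path by metis
qed

theorem theorem54:
  fixes n :: nat
  assumes "n \<ge> 1"
  shows "\<exists>\<beta> :: bool list \<times> bool list \<Rightarrow> bool list \<times> bool list.
    (\<forall>I \<in> tamari_intervals n. \<beta> I \<in> tamari_intervals n \<and> \<beta> (\<beta> I) = I) \<and>
    (\<forall>P Q P' Q'. (P, Q) \<in> tamari_intervals n \<longrightarrow> \<beta> (P, Q) = (P', Q') \<longrightarrow>
        contact P' 0 = rise Q 0 \<and> rise Q' 0 = contact P 0 \<and>
        mset (map (contact P') [1..<n]) = mset (map (rise Q) [1..<n]) \<and>
        mset (map (rise Q') [1..<n]) = mset (map (contact P) [1..<n]) \<and>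
        dist P' Q' = dist P Q)"
proof -
  \<comment> \<open>A choice makes \<open>\<beta>\<close> total on pairs of words; on intervals it
    is forced by \<open>path_inject\<close> and \<open>swaps_unique\<close>.\<close>
  define \<beta> where "\<beta> I = (SOME J. \<exists>p q p' q'. I = (path p, path q) \<and> J = (path p', path q') \<and>
    swaps p q p' q')" for I
  have \<beta>: "\<beta> (path p, path q) = (path p', path q')" if "swaps p q p' q'" for p q p' q'
    unfolding \<beta>_def
  proof (rule some_equality)
    show "\<exists>u v u' v'. (path p, path q) = (path u, path v) \<and>
      (path p', path q') = (path u', path v') \<and> swaps u v u' v'"
      using that by blast
    fix J assume "\<exists>u v u' v'. (path p, path q) = (path u, path v) \<and>
      J = (path u', path v') \<and> swaps u v u' v'"
    then show "J = (path p', path q')" using swaps_unique[OF that] by auto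
  qed
  have ex: "\<exists>p q p' q'. P = path p \<and> Q = path q \<and> size p = n \<and> size q = n \<and> swaps p q p' q'"
    if "(P, Q) \<in> tamari_intervals n" for P Q
    using that swaps_total unfolding tamari_intervals_path by metis
  show ?thesis
  proof (intro exI[of _ \<beta>] conjI ballI allI impI)
    fix I assume "I \<in> tamari_intervals n"
    then obtain p q p' q' where *: "I = (path p, path q)" "size p = n" "swaps p q p' q'"
      using ex by (cases I) blast
    show "\<beta> I \<in> tamari_intervals n"
      using \<beta>[OF *(3)] swaps_stats(1-3)[OF *(3)] *(1,2) by (auto simp: tamari_intervals_path)
    show "\<beta> (\<beta> I) = I"
      using \<beta>[OF *(3)] \<beta>[OF swaps_sym[OF *(3)]] *(1) by simp
  next
    fix P Q P' Q' assume "(P, Q) \<in> tamari_intervals n" and eq: "\<beta> (P, Q) = (P', Q')"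
    then obtain p q p' q' where *: "P = path p" "Q = path q" "size p = n" "size q = n"
      "swaps p q p' q'" using ex by blast
    then have [simp]: "P' = path p'" "Q' = path q'" using \<beta>[OF *(5)] eq by auto
    note st = swaps_stats[OF *(5)]
    have nL: "p \<noteq> L" "q \<noteq> L" "p' \<noteq> L" "q' \<noteq> L" using assms st(2,3) *(3,4) by auto
    show "contact P' 0 = rise Q 0" "rise Q' 0 = contact P 0" "dist P' Q' = dist P Q"
      using st *(1,2) by (simp_all add: contact_path_0 rise_0)
    \<comment> \<open>Both multisets, completed by the same entry 0, agree; the entry
      cancels.\<close>
    show "mset (map (contact P') [1..<n]) = mset (map (rise Q) [1..<n])"
      using contacts_path[OF nL(3)] rises_path[OF nL(2)] st(2,6) *(1-4)
      by (metis \<open>P' = path p'\<close> add_mset_add_mset_same_iff)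
    show "mset (map (rise Q') [1..<n]) = mset (map (contact P) [1..<n])"
      using contacts_path[OF nL(1)] rises_path[OF nL(4)] st(3,7) *(1-4)
      by (metis \<open>Q' = path q'\<close> add_mset_add_mset_same_iff)
  qed
qed

end
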